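(* Let $(A,\mu,\alpha,\beta)$ be a left BiHom-alternative algebra over a field $\mathbb{K}$ of characteristic $0$ such that $H^2_{\alpha,\beta}(A;A)=0$. Then $(A,\mu,\alpha,\beta)$ is analytically rigid.
   Context: Write $xy=\mu(x,y)$. A left BiHom-alternative algebra $(A,\mu,\alpha,\beta)$ is a $\mathbb{K}$-vector space $A$ with a bilinear map $\mu:A\times A\to A$ and linear maps $\alpha,\beta:A\to A$ such that $\alpha\beta=\beta\alpha$, $\alpha(xy)=\alpha(x)\alpha(y)$, $\beta(xy)=\beta(x)\beta(y)$, and for all $x,y,z\in A$ $$as_{\alpha,\beta}(\beta(x),\alpha(y),z)+as_{\alpha,\beta}(\beta(y),\alpha(x),z)=0,$$ where $as_{\alpha,\beta}(x,y,z)=(xy)\beta(z)-\alpha(x)(yz)$. A one-parameter formal deformation of $(A,\mu,\alpha,\beta)$ is a formal power series $d_t=\sum_{i\ge0}d_it^i$, where each $d_i:A\times A\to A$ is $\mathbb{K}$-bilinear (extended $\mathbb{K}[[t]]$-bilinearly to $A[[t]]$; $\alpha,\beta$ are extended $\mathbb{K}[[t]]$-linearly) and $d_0=\mu$, such that $d_t(\alpha(x),\alpha(y))=\alpha(d_t(x,y))$, $d_t(\beta(x),\beta(y))=\beta(d_t(x,y))$ and $$d_t(d_t(\beta(x),\alpha(y)),\beta(z))-d_t(\alpha\beta(x),d_t(\alpha(y),z))+d_t(d_t(\beta(y),\alpha(x)),\beta(z))-d_t(\alpha\beta(y),d_t(\alpha(x),z))=0.$$ Two deformations $d_t,d'_t$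 are equivalent, $d_t\sim d'_t$, if there is a formal isomorphism of $\mathbb{K}[[t]]$-modules $\phi_t=\sum_{i\ge0}\phi_it^i:A[[t]]\to A[[t]]$, with each $\phi_i:A\to A$ $\mathbb{K}$-linear (extended $\mathbb{K}[[t]]$-linearly) and $\phi_0=\mathrm{Id}_A$, such that $\phi_t\circ\alpha=\alpha\circ\phi_t$, $\phi_t\circ\beta=\beta\circ\phi_t$ and $\phi_t(d_t(x,y))=d'_t(\phi_t(x),\phi_t(y))$. A deformation $d_t$ is trivial if $d_t\sim d_0$, where $d_0=\mu$ is viewed as the null deformation (all higher coefficients zero). The algebra is analytically rigid if every one-parameter formal deformation of it is trivial. $C^n_{\alpha,\beta}(A;A)$ is the space of $n$-linear maps $f:A^n\to A$ with $\alpha f(x_1,\dots,x_n)=f(\alpha(x_1),\dots,\alpha(x_n))$ and $\beta f(x_1,\dots,x_n)=f(\beta(x_1),\dots,\beta(x_n))$. For $f\in C^1_{\alpha,\beta}(A;A)$, $\delta^1f(x,y)=xf(y)+f(x)y-f(xy)$. For $f\in C^2_{\alpha,\beta}(A;A)$, $$\delta^2f(x,y,z)=f(\beta(x),\alpha(y))\beta(z)-\alpha\beta(x)f(\alpha(y),z)+f(\beta(y),\alpha(x))\beta(z)-\alpha\beta(y)f(\alpha(x),z)$$ $$\qquad+f(\beta(x)\alpha(y),\beta(z))-f(\alpha\beta(x),\alpha(y)z)+f(\beta(y)\alpha(x),\beta(z))-f(\alpha\beta(y),\alpha(x)z).$$ One has $\delta^2\circ\delta^1=0$; $Z^2_{\alpha,\beta}(A;A)=\ker\delta^2$,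 $B^2_{\alpha,\beta}(A;A)=\delta^1(C^1_{\alpha,\beta}(A;A))$, $H^2_{\alpha,\beta}(A;A)=Z^2_{\alpha,\beta}(A;A)/B^2_{\alpha,\beta}(A;A)$. *)

theory Defs
  imports "HOL-Computational_Algebra.Formal_Power_Series"
begin

section \<open>Left BiHom-alternative algebras\<close>

definition bilinear_map :: "('k::field \<Rightarrow> 'a::ab_group_add \<Rightarrow> 'a) \<Rightarrow> ('a \<Rightarrow> 'a \<Rightarrow> 'a) \<Rightarrow> bool" where
  "bilinear_map scale f \<longleftrightarrow>
     (\<forall>x. Vector_Spaces.linear scale scale (\<lambda>y. f x y)) \<and>
     (\<forall>y. Vector_Spaces.linear scale scale (\<lambda>x. f x y))"

definition bihom_associator ::
  "('a::ab_group_add \<Rightarrow> 'a \<Rightarrow> 'a) \<Rightarrow> ('a \<Rightarrow> 'a) \<Rightarrow> ('a \<Rightarrow> 'a) \<Rightarrow> 'a \<Rightarrow> 'a \<Rightarrow> 'a \<Rightarrow> 'a" where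
  "bihom_associator \<mu> \<alpha> \<beta> x y z = \<mu> (\<mu> x y) (\<beta> z) - \<mu> (\<alpha> x) (\<mu> y z)"

locale left_bihom_alternative = vector_space scale
  for scale :: "'k::field \<Rightarrow> 'a::ab_group_add \<Rightarrow> 'a" +
  fixes \<mu> :: "'a \<Rightarrow> 'a \<Rightarrow> 'a" and \<alpha> \<beta> :: "'a \<Rightarrow> 'a"
  assumes bilinear_mult: "bilinear_map scale \<mu>"
    and linear_alpha: "Vector_Spaces.linear scale scale \<alpha>"
    and linear_beta: "Vector_Spaces.linear scale scale \<beta>"
    and alpha_beta: "\<alpha> (\<beta> x) = \<beta> (\<alpha> x)"
    and alpha_mult: "\<alpha> (\<mu> x y) = \<mu> (\<alpha> x) (\<alpha> y)"
    and beta_mult: "\<beta> (\<mu> x y) = \<mu> (\<beta> x) (\<beta> y)"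
    and left_alternative:
      "bihom_associator \<mu> \<alpha> \<beta> (\<beta> x) (\<alpha> y) z + bihom_associator \<mu> \<alpha> \<beta> (\<beta> y) (\<alpha> x) z = 0"

section \<open>Second cohomology\<close>

definition C1 :: "('k::field \<Rightarrow> 'a::ab_group_add \<Rightarrow> 'a) \<Rightarrow> ('a \<Rightarrow> 'a) \<Rightarrow> ('a \<Rightarrow> 'a) \<Rightarrow> ('a \<Rightarrow> 'a) set" where
  "C1 scale \<alpha> \<beta> = {f. Vector_Spaces.linear scale scale f \<and>
     (\<forall>x. \<alpha> (f x) = f (\<alpha> x)) \<and> (\<forall>x. \<beta> (f x) = f (\<beta> x))}"

definition C2 :: "('k::field \<Rightarrow> 'a::ab_group_add \<Rightarrow> 'a) \<Rightarrow> ('a \<Rightarrow> 'a) \<Rightarrow> ('a \<Rightarrow> 'a) \<Rightarrow> ('a \<Rightarrow> 'a \<Rightarrow> 'a) set" where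
  "C2 scale \<alpha> \<beta> = {f. bilinear_map scale f \<and>
     (\<forall>x y. \<alpha> (f x y) = f (\<alpha> x) (\<alpha> y)) \<and> (\<forall>x y. \<beta> (f x y) = f (\<beta> x) (\<beta> y))}"

definition delta1 :: "('a::ab_group_add \<Rightarrow> 'a \<Rightarrow> 'a) \<Rightarrow> ('a \<Rightarrow> 'a) \<Rightarrow> 'a \<Rightarrow> 'a \<Rightarrow> 'a" where
  "delta1 \<mu> f x y = \<mu> x (f y) + \<mu> (f x) y - f (\<mu> x y)"

definition delta2 ::
  "('a::ab_group_add \<Rightarrow> 'a \<Rightarrow> 'a) \<Rightarrow> ('a \<Rightarrow> 'a) \<Rightarrow> ('a \<Rightarrow> 'a) \<Rightarrow> ('a \<Rightarrow> 'a \<Rightarrow> 'a) \<Rightarrow> 'a \<Rightarrow> 'a \<Rightarrow> 'a \<Rightarrow> 'a" where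
  "delta2 \<mu> \<alpha> \<beta> f x y z =
      \<mu> (f (\<beta> x) (\<alpha> y)) (\<beta> z) - \<mu> (\<alpha> (\<beta> x)) (f (\<alpha> y) z)
    + \<mu> (f (\<beta> y) (\<alpha> x)) (\<beta> z) - \<mu> (\<alpha> (\<beta> y)) (f (\<alpha> x) z)
    + f (\<mu> (\<beta> x) (\<alpha> y)) (\<beta> z) - f (\<alpha> (\<beta> x)) (\<mu> (\<alpha> y) z)
    + f (\<mu> (\<beta> y) (\<alpha> x)) (\<beta> z) - f (\<alpha> (\<beta> y)) (\<mu> (\<alpha> x) z)"

definition Z2 ::
  "('k::field \<Rightarrow> 'a::ab_group_add \<Rightarrow> 'a) \<Rightarrow> ('a \<Rightarrow> 'a \<Rightarrow> 'a) \<Rightarrow> ('a \<Rightarrow> 'a) \<Rightarrow> ('a \<Rightarrow> 'a) \<Rightarrow> ('a \<Rightarrow> 'a \<Rightarrow> 'a) set" where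
  "Z2 scale \<mu> \<alpha> \<beta> = {f \<in> C2 scale \<alpha> \<beta>. \<forall>x y z. delta2 \<mu> \<alpha> \<beta> f x y z = 0}"

definition B2 ::
  "('k::field \<Rightarrow> 'a::ab_group_add \<Rightarrow> 'a) \<Rightarrow> ('a \<Rightarrow> 'a \<Rightarrow> 'a) \<Rightarrow> ('a \<Rightarrow> 'a) \<Rightarrow> ('a \<Rightarrow> 'a) \<Rightarrow> ('a \<Rightarrow> 'a \<Rightarrow> 'a) set" where
  "B2 scale \<mu> \<alpha> \<beta> = delta1 \<mu> ` C1 scale \<alpha> \<beta>"

definition B2_coset ::
  "('k::field \<Rightarrow> 'a::ab_group_add \<Rightarrow> 'a) \<Rightarrow> ('a \<Rightarrow> 'a \<Rightarrow> 'a) \<Rightarrow> ('a \<Rightarrow> 'a) \<Rightarrow> ('a \<Rightarrow> 'a)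
    \<Rightarrow> ('a \<Rightarrow> 'a \<Rightarrow> 'a) \<Rightarrow> ('a \<Rightarrow> 'a \<Rightarrow> 'a) set" where
  "B2_coset scale \<mu> \<alpha> \<beta> f = (\<lambda>b x y. f x y + b x y) ` B2 scale \<mu> \<alpha> \<beta>"

text \<open>The underlying set of the quotient space Z2/B2; its zero vector is the coset of the zero map.\<close>

definition H2 ::
  "('k::field \<Rightarrow> 'a::ab_group_add \<Rightarrow> 'a) \<Rightarrow> ('a \<Rightarrow> 'a \<Rightarrow> 'a) \<Rightarrow> ('a \<Rightarrow> 'a) \<Rightarrow> ('a \<Rightarrow> 'a) \<Rightarrow> ('a \<Rightarrow> 'a \<Rightarrow> 'a) set set" where
  "H2 scale \<mu> \<alpha> \<beta> = B2_coset scale \<mu> \<alpha> \<beta> ` Z2 scale \<mu> \<alpha> \<beta>"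

definition H2_zero ::
  "('k::field \<Rightarrow> 'a::ab_group_add \<Rightarrow> 'a) \<Rightarrow> ('a \<Rightarrow> 'a \<Rightarrow> 'a) \<Rightarrow> ('a \<Rightarrow> 'a) \<Rightarrow> ('a \<Rightarrow> 'a) \<Rightarrow> ('a \<Rightarrow> 'a \<Rightarrow> 'a) set" where
  "H2_zero scale \<mu> \<alpha> \<beta> = B2_coset scale \<mu> \<alpha> \<beta> (\<lambda>_ _. 0)"

lemma (in left_bihom_alternative) B2_subset_Z2: "B2 scale \<mu> \<alpha> \<beta> \<subseteq> Z2 scale \<mu> \<alpha> \<beta>"
proof
  fix g assume "g \<in> B2 scale \<mu> \<alpha> \<beta>"
  then obtain f where f: "Vector_Spaces.linear scale scale f"
    and fa: "\<And>x. \<alpha> (f x) = f (\<alpha> x)" and fb: "\<And>x. \<beta> (f x) = f (\<beta> x)"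
    and g: "g = delta1 \<mu> f" by (auto simp: B2_def C1_def)
  have hom: "module_hom scale scale h" if "Vector_Spaces.linear scale scale h" for h
    using that by (simp add: Vector_Spaces.linear_def)
  have mr: "module_hom scale scale (\<mu> x)" for x
    using bilinear_mult by (auto simp: bilinear_map_def intro!: hom)
  have ml: "module_hom scale scale (\<lambda>x. \<mu> x y)" for y
    using bilinear_mult by (auto simp: bilinear_map_def intro!: hom)
  note simps =
    module_hom.add[OF hom[OF f]] module_hom.diff[OF hom[OF f]] module_hom.scale[OF hom[OF f]]
    module_hom.add[OF hom[OF linear_alpha]] module_hom.diff[OF hom[OF linear_alpha]]
    module_hom.add[OF hom[OF linear_beta]] module_hom.diff[OF hom[OF linear_beta]]
    module_hom.add[OF mr] module_hom.diff[OF mr] module_hom.scale[OF mr]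
    module_hom.add[OF ml] module_hom.diff[OF ml] module_hom.scale[OF ml]
  have "bilinear_map scale g"
    unfolding bilinear_map_def Vector_Spaces.linear_def g delta1_def
    by (auto intro!: vector_space_axioms module_hom.intro module_hom_axioms.intro module_axioms
        simp: simps algebra_simps)
  moreover have "\<alpha> (g x y) = g (\<alpha> x) (\<alpha> y)" "\<beta> (g x y) = g (\<beta> x) (\<beta> y)" for x y
    by (simp_all add: g delta1_def simps fa fb alpha_mult beta_mult)
  moreover have "delta2 \<mu> \<alpha> \<beta> g x y z = 0" for x y z
  proof -
    let ?T = "\<lambda>x y z. bihom_associator \<mu> \<alpha> \<beta> (\<beta> x) (\<alpha> y) z + bihom_associator \<mu> \<alpha> \<beta> (\<beta> y) (\<alpha> x) z"
    have "delta2 \<mu> \<alpha> \<beta> g x y z = ?T (f x) y z + ?T x (f y) z + ?T x y (f z) - f (?T x y z)"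
      by (simp add: g delta1_def delta2_def bihom_associator_def simps fa fb alpha_mult beta_mult
          alpha_beta algebra_simps)
    then show ?thesis
      by (simp only: left_alternative module_hom.zero[OF hom[OF f]]) simp
  qed
  ultimately show "g \<in> Z2 scale \<mu> \<alpha> \<beta>"
    by (auto simp: Z2_def C2_def)
qed

section \<open>Formal deformations\<close>

unbundle fps_syntax

text \<open>
  \<open>A[[t]]\<close> is the type of formal power series over the type of \<open>A\<close>. Formal power series
  \<open>\<Sum>\<^sub>i \<phi>\<^sub>i t\<^sup>i\<close> and \<open>\<Sum>\<^sub>i d\<^sub>i t\<^sup>i\<close> of (bi)linear maps are given by their coefficient
  sequences; the functions below are their \<open>K[[t]]\<close>-(bi)linear extensions to \<open>A[[t]]\<close>,
  together with the action of \<open>K[[t]]\<close> on \<open>A[[t]]\<close>.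
\<close>

definition fps_scale :: "('k::field \<Rightarrow> 'a::ab_group_add \<Rightarrow> 'a) \<Rightarrow> 'k fps \<Rightarrow> 'a fps \<Rightarrow> 'a fps" where
  "fps_scale scale c f = Abs_fps (\<lambda>n. \<Sum>i\<le>n. scale (c $ i) (f $ (n - i)))"

definition linear_ext :: "(nat \<Rightarrow> 'a::ab_group_add \<Rightarrow> 'a) \<Rightarrow> 'a fps \<Rightarrow> 'a fps" where
  "linear_ext \<phi> f = Abs_fps (\<lambda>n. \<Sum>i\<le>n. \<phi> i (f $ (n - i)))"

definition bilinear_ext :: "(nat \<Rightarrow> 'a::ab_group_add \<Rightarrow> 'a \<Rightarrow> 'a) \<Rightarrow> 'a fps \<Rightarrow> 'a fps \<Rightarrow> 'a fps" where
  "bilinear_ext d f g = Abs_fps (\<lambda>n. \<Sum>i\<le>n. \<Sum>j\<le>n - i. d i (f $ j) (g $ (n - i - j)))"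

definition coeffwise :: "('a \<Rightarrow> 'a) \<Rightarrow> 'a fps \<Rightarrow> 'a fps" where
  "coeffwise \<alpha> f = Abs_fps (\<lambda>n. \<alpha> (f $ n))"

text \<open>
  The identities are imposed on elements of \<open>A\<close>, embedded as constant series; by
  \<open>K[[t]]\<close>-multilinearity they then hold on all of \<open>A[[t]]\<close>.
\<close>

definition formal_deformation ::
  "('k::field \<Rightarrow> 'a::ab_group_add \<Rightarrow> 'a) \<Rightarrow> ('a \<Rightarrow> 'a \<Rightarrow> 'a) \<Rightarrow> ('a \<Rightarrow> 'a) \<Rightarrow> ('a \<Rightarrow> 'a)
    \<Rightarrow> (nat \<Rightarrow> 'a \<Rightarrow> 'a \<Rightarrow> 'a) \<Rightarrow> bool" where
  "formal_deformation scale \<mu> \<alpha> \<beta> d \<longleftrightarrow>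
     (\<forall>i. bilinear_map scale (d i)) \<and> d 0 = \<mu> \<and>
     (let D = bilinear_ext d; c = fps_const in
       (\<forall>x y. D (c (\<alpha> x)) (c (\<alpha> y)) = coeffwise \<alpha> (D (c x) (c y))) \<and>
       (\<forall>x y. D (c (\<beta> x)) (c (\<beta> y)) = coeffwise \<beta> (D (c x) (c y))) \<and>
       (\<forall>x y z.
           D (D (c (\<beta> x)) (c (\<alpha> y))) (c (\<beta> z)) - D (c (\<alpha> (\<beta> x))) (D (c (\<alpha> y)) (c z))
         + D (D (c (\<beta> y)) (c (\<alpha> x))) (c (\<beta> z)) - D (c (\<alpha> (\<beta> y))) (D (c (\<alpha> x)) (c z)) = 0))"

definition deformation_equiv ::
  "('k::field \<Rightarrow> 'a::ab_group_add \<Rightarrow> 'a) \<Rightarrow> ('a \<Rightarrow> 'a) \<Rightarrow> ('a \<Rightarrow> 'a)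
    \<Rightarrow> (nat \<Rightarrow> 'a \<Rightarrow> 'a \<Rightarrow> 'a) \<Rightarrow> (nat \<Rightarrow> 'a \<Rightarrow> 'a \<Rightarrow> 'a) \<Rightarrow> bool" where
  "deformation_equiv scale \<alpha> \<beta> d d' \<longleftrightarrow>
     (\<exists>\<phi>. (\<forall>i. Vector_Spaces.linear scale scale (\<phi> i)) \<and> \<phi> 0 = id \<and>
       (let \<Phi> = linear_ext \<phi> in
         module_hom (fps_scale scale) (fps_scale scale) \<Phi> \<and> bij \<Phi> \<and>
         \<Phi> \<circ> coeffwise \<alpha> = coeffwise \<alpha> \<circ> \<Phi> \<and>
         \<Phi> \<circ> coeffwise \<beta> = coeffwise \<beta> \<circ> \<Phi> \<and>
         (\<forall>f g. \<Phi> (bilinear_ext d f g) = bilinear_ext d' (\<Phi> f) (\<Phi> g))))"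

definition null_deformation :: "('a::ab_group_add \<Rightarrow> 'a \<Rightarrow> 'a) \<Rightarrow> nat \<Rightarrow> 'a \<Rightarrow> 'a \<Rightarrow> 'a" where
  "null_deformation \<mu> i = (if i = 0 then \<mu> else (\<lambda>_ _. 0))"

definition trivial_deformation ::
  "('k::field \<Rightarrow> 'a::ab_group_add \<Rightarrow> 'a) \<Rightarrow> ('a \<Rightarrow> 'a) \<Rightarrow> ('a \<Rightarrow> 'a) \<Rightarrow> (nat \<Rightarrow> 'a \<Rightarrow> 'a \<Rightarrow> 'a) \<Rightarrow> bool" where
  "trivial_deformation scale \<alpha> \<beta> d \<longleftrightarrow> deformation_equiv scale \<alpha> \<beta> d (null_deformation (d 0))"

definition analytically_rigid ::
  "('k::field \<Rightarrow> 'a::ab_group_add \<Rightarrow> 'a) \<Rightarrow> ('a \<Rightarrow> 'a \<Rightarrow> 'a) \<Rightarrow> ('a \<Rightarrow> 'a) \<Rightarrow> ('a \<Rightarrow> 'a) \<Rightarrow> bool" where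
  "analytically_rigid scale \<mu> \<alpha> \<beta> \<longleftrightarrow>
     (\<forall>d. formal_deformation scale \<mu> \<alpha> \<beta> d \<longrightarrow> trivial_deformation scale \<alpha> \<beta> d)"

end

theory Submission
  imports Defs
begin

text \<open>
  An isomorphism \<open>\<Phi> = id + \<phi>\<^sub>1 t + \<dots>\<close> from a deformation \<open>D\<close> to the null deformation \<open>M\<close> is
  built one coefficient at a time. If \<open>\<Phi> (D x y) - M (\<Phi> x) (\<Phi> y)\<close> vanishes to order \<open>n\<close> on
  constants, let \<open>\<psi>\<close> be its coefficient at \<open>t\<^sup>n\<close>. Apply \<open>\<Phi>\<close> to the left alternative identity of \<open>D\<close>
  and move \<open>\<Phi>\<close> inside: at order \<open>n\<close> this leaves the left alternative identity of \<open>M\<close> at \<open>\<Phi> x\<close>,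
  \<open>\<Phi> y\<close>, \<open>\<Phi> z\<close>, which holds, plus exactly \<open>\<delta>\<^sup>2 \<psi>\<close>. So \<open>\<psi>\<close> is a cocycle, hence \<open>\<psi> = \<delta>\<^sup>1 r\<close>, and
  \<open>\<phi>\<^sub>n = r\<close> removes the defect at order \<open>n\<close>.
\<close>

section \<open>Modules of formal power series\<close>

text \<open>Both sides sum \<open>F a b c\<close> over all \<open>a + b + c = n\<close>; the left
  groups the first two indices, the right the last two. This index change underlies associativity of
  power series products.\<close>

lemma sum_triangle_assoc:
  fixes F :: "nat \<Rightarrow> nat \<Rightarrow> nat \<Rightarrow> 'a::comm_monoid_add"
  shows "(\<Sum>j\<le>n. \<Sum>i\<le>j. F i (j - i) (n - j)) = (\<Sum>j\<le>n. \<Sum>i\<le>n - j. F j i (n - j - i))"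
  using fps_mult_assoc_lemma[of F n n] by (simp add: atLeast0AtMost)

lemma sum_atMost_rev:
  fixes F :: "nat \<Rightarrow> nat \<Rightarrow> 'a::comm_monoid_add"
  shows "(\<Sum>i\<le>n. F i (n - i)) = (\<Sum>i\<le>n. F (n - i) i)"
  using fps_mult_commute_lemma[of F n] by (simp add: atLeast0AtMost)

text \<open>Grouping the two indices to be exchanged into one inner sum reduces the swap to
  reversing that sum.\<close>

lemma sum_triangle_swap:
  fixes F :: "nat \<Rightarrow> nat \<Rightarrow> nat \<Rightarrow> 'a::comm_monoid_add"
  shows "(\<Sum>j\<le>n. \<Sum>i\<le>n - j. F j i (n - j - i)) = (\<Sum>j\<le>n. \<Sum>i\<le>n - j. F i j (n - j - i))"
proof -
  have "(\<Sum>j\<le>n. \<Sum>i\<le>n - j. F j i (n - j - i)) = (\<Sum>j\<le>n. \<Sum>i\<le>j. F i (j - i) (n - j))"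
    by (rule sum_triangle_assoc[symmetric])
  also have "\<dots> = (\<Sum>j\<le>n. \<Sum>i\<le>j. F (j - i) i (n - j))"
    by (rule sum.cong[OF refl], rule sum_atMost_rev[where F = "\<lambda>a b. F a b _"])
  also have "\<dots> = (\<Sum>j\<le>n. \<Sum>i\<le>n - j. F i j (n - j - i))"
    by (rule sum_triangle_assoc[where F = "\<lambda>a b c. F b a c"])
  finally show ?thesis .
qed

lemma linear_ext_nth: "linear_ext \<phi> f $ n = (\<Sum>i\<le>n. \<phi> i (f $ (n - i)))"
  by (simp add: linear_ext_def)

lemma bilinear_ext_nth:
  "bilinear_ext d f g $ n = (\<Sum>i\<le>n. \<Sum>j\<le>n - i. d i (f $ j) (g $ (n - i - j)))"
  by (simp add: bilinear_ext_def)

text \<open>Fixing one argument turns a bilinear extension into a linear one with new coefficient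
  maps, so facts about \<open>linear_ext\<close> apply in each argument.\<close>

lemma bilinear_ext_left:
  "bilinear_ext d f g = linear_ext (\<lambda>m x. \<Sum>i\<le>m. d i x (g $ (m - i))) f"
proof (rule fps_ext)
  fix n
  have "bilinear_ext d f g $ n = (\<Sum>i\<le>n. \<Sum>j\<le>n - i. d i (f $ (n - i - j)) (g $ j))"
    unfolding bilinear_ext_nth
    by (rule sum.cong[OF refl], rule sum_atMost_rev[where F = "\<lambda>a b. d _ (f $ a) (g $ b)"])
  also have "\<dots> = (\<Sum>m\<le>n. \<Sum>i\<le>m. d i (f $ (n - m)) (g $ (m - i)))"
    by (rule sum_triangle_assoc[where F = "\<lambda>i a b. d i (f $ b) (g $ a)", symmetric])
  finally show "bilinear_ext d f g $ n
      = linear_ext (\<lambda>m x. \<Sum>i\<le>m. d i x (g $ (m - i))) f $ n"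
    by (simp add: linear_ext_nth)
qed

lemma bilinear_ext_right:
  "bilinear_ext d f g = linear_ext (\<lambda>m y. \<Sum>i\<le>m. d i (f $ (m - i)) y) g"
proof (rule fps_ext)
  fix n
  show "bilinear_ext d f g $ n = linear_ext (\<lambda>m y. \<Sum>i\<le>m. d i (f $ (m - i)) y) g $ n"
    unfolding bilinear_ext_nth linear_ext_nth
    by (rule sum_triangle_assoc[where F = "\<lambda>i a b. d i (f $ a) (g $ b)", symmetric])
qed

context vector_space
begin

lemma fps_scale_nth: "fps_scale scale c f $ n = (\<Sum>i\<le>n. scale (c $ i) (f $ (n - i)))"
  by (simp add: fps_scale_def)

lemma module_fps_scale: "module (fps_scale scale)"
proof
  fix a b :: "'a fps" and f g :: "'b fps"
  show "fps_scale scale a (f + g) = fps_scale scale a f + fps_scale scale a g"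
    by (rule fps_ext) (simp add: fps_scale_nth scale_right_distrib sum.distrib)
  show "fps_scale scale (a + b) f = fps_scale scale a f + fps_scale scale b f"
    by (rule fps_ext) (simp add: fps_scale_nth scale_left_distrib sum.distrib)
  show "fps_scale scale a (fps_scale scale b f) = fps_scale scale (a * b) f"
  proof (rule fps_ext)
    fix n
    have "fps_scale scale a (fps_scale scale b f) $ n
        = (\<Sum>j\<le>n. \<Sum>i\<le>n - j. scale (a $ j * b $ i) (f $ (n - j - i)))"
      by (simp add: fps_scale_nth scale_sum_right)
    also have "\<dots> = (\<Sum>j\<le>n. \<Sum>i\<le>j. scale (a $ i * b $ (j - i)) (f $ (n - j)))"
      by (rule sum_triangle_assoc[where F = "\<lambda>i j k. scale (a $ i * b $ j) (f $ k)", symmetric])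
    also have "\<dots> = fps_scale scale (a * b) f $ n"
      by (simp add: fps_scale_nth fps_mult_nth scale_sum_left atLeast0AtMost)
    finally show "fps_scale scale a (fps_scale scale b f) $ n = fps_scale scale (a * b) f $ n" .
  qed
  show "fps_scale scale 1 f = f"
  proof (rule fps_ext)
    fix n
    have "fps_scale scale 1 f $ n = (\<Sum>i\<le>n. if i = 0 then f $ n else 0)"
      unfolding fps_scale_nth by (rule sum.cong) auto
    then show "fps_scale scale 1 f $ n = f $ n" by simp
  qed
qed

lemma fps_scale_X_nth: "fps_scale scale fps_X f $ n = (if n = 0 then 0 else f $ (n - 1))"
proof -
  have "fps_scale scale fps_X f $ n = (\<Sum>i\<le>n. if i = 1 then f $ (n - 1) else 0)"
    unfolding fps_scale_nth by (rule sum.cong) auto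
  then show ?thesis by (cases n) auto
qed

lemma fps_const_plus_X_shift:
  "f = fps_const (f $ 0) + fps_scale scale fps_X (fps_shift 1 f)"
  by (rule fps_ext) (simp add: fps_scale_X_nth)

text \<open>Split \<open>f\<close> into its constant term and \<open>fps_X\<close> times its shift.
  By linearity the second part contributes to order \<open>m\<close> only the coefficient at
  \<open>m - 1\<close> of \<open>L\<close> on the shifted series, and the induction hypothesis for
  that series makes it vanish.\<close>

lemma module_hom_fps_nth_le:
  assumes L: "module_hom (fps_scale scale) (fps_scale scale) L"
    and const: "\<And>m x. m < n \<Longrightarrow> L (fps_const x) $ m = 0"
    and "m \<le> n"
  shows "L f $ m = L (fps_const (f $ 0)) $ m"
  using \<open>m \<le> n\<close>
proof (induction m arbitrary: f)
  case IH: (Suc m f)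
  have "L f = L (fps_const (f $ 0)) + fps_scale scale fps_X (L (fps_shift 1 f))"
    by (subst fps_const_plus_X_shift) (simp only: module_hom.add[OF L] module_hom.scale[OF L])
  moreover have "L (fps_shift 1 f) $ m = 0"
    using IH const by simp
  ultimately show ?case by (simp add: fps_scale_X_nth)
next
  case (0 f)
  have "L f = L (fps_const (f $ 0)) + fps_scale scale fps_X (L (fps_shift 1 f))"
    by (subst fps_const_plus_X_shift) (simp only: module_hom.add[OF L] module_hom.scale[OF L])
  then show ?case by (simp add: fps_scale_X_nth)
qed

text \<open>Compatibility with scalars is an exchange of summation: the scalar coefficient and the
  index of \<open>\<phi>\<close> trade places in a triple sum.\<close>

lemma module_hom_linear_ext:
  assumes "\<And>i. module_hom scale scale (\<phi> i)"
  shows "module_hom (fps_scale scale) (fps_scale scale) (linear_ext \<phi>)"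
  unfolding module_hom_iff
proof (intro conjI allI module_fps_scale)
  note hom = module_hom.add[OF assms] module_hom.scale[OF assms] module_hom.sum[OF assms]
  fix c f g
  show "linear_ext \<phi> (f + g) = linear_ext \<phi> f + linear_ext \<phi> g"
    by (rule fps_ext) (simp add: linear_ext_nth hom sum.distrib)
  show "linear_ext \<phi> (fps_scale scale c f) = fps_scale scale c (linear_ext \<phi> f)"
  proof (rule fps_ext)
    fix n
    show "linear_ext \<phi> (fps_scale scale c f) $ n = fps_scale scale c (linear_ext \<phi> f) $ n"
      using sum_triangle_swap[of "\<lambda>i j k. scale (c $ j) (\<phi> i (f $ k))" n]
      by (simp add: linear_ext_nth fps_scale_nth hom scale_sum_right)
  qed
qed

lemma bilinear_map_module_hom:
  assumes "bilinear_map scale f"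
  shows "module_hom scale scale (f x)" "module_hom scale scale (\<lambda>x. f x y)"
  using assms by (auto simp: bilinear_map_def Vector_Spaces.linear_def)

lemma linearI_module_hom: "module_hom scale scale f \<Longrightarrow> Vector_Spaces.linear scale scale f"
  by (simp add: Vector_Spaces.linear_def vector_space_axioms)

lemma module_hom_sum_self:
  "(\<And>i. i \<in> I \<Longrightarrow> module_hom scale scale (f i)) \<Longrightarrow> module_hom scale scale (\<lambda>x. \<Sum>i\<in>I. f i x)"
  by (rule module_pair.module_hom_sum) (auto intro: module_pair.intro module_axioms)

lemma module_hom_bilinear_ext:
  assumes "\<And>i. bilinear_map scale (d i)"
  shows "module_hom (fps_scale scale) (fps_scale scale) (bilinear_ext d f)"
    and "module_hom (fps_scale scale) (fps_scale scale) (\<lambda>f. bilinear_ext d f g)"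
proof -
  show "module_hom (fps_scale scale) (fps_scale scale) (bilinear_ext d f)"
    unfolding bilinear_ext_right[abs_def]
    by (intro module_hom_linear_ext module_hom_sum_self bilinear_map_module_hom assms)
  show "module_hom (fps_scale scale) (fps_scale scale) (\<lambda>f. bilinear_ext d f g)"
    unfolding bilinear_ext_left
    by (intro module_hom_linear_ext module_hom_sum_self bilinear_map_module_hom assms)
qed

text \<open>With \<open>\<phi> 0 = id\<close> the extension is unitriangular in the coefficients, so
  it can be inverted one coefficient at a time.\<close>

lemma bij_linear_ext:
  assumes "\<And>i. module_hom scale scale (\<phi> i)" and id: "\<phi> 0 = id"
  shows "bij (linear_ext \<phi>)"
proof (rule bijI)
  have nth: "linear_ext \<phi> f $ n = f $ n + (\<Sum>i<n. \<phi> (n - i) (f $ i))" for f n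
  proof -
    have "linear_ext \<phi> f $ n = (\<Sum>i\<le>n. \<phi> (n - i) (f $ i))"
      unfolding linear_ext_nth by (rule sum_atMost_rev[where F = "\<lambda>a b. \<phi> a (f $ b)"])
    then show ?thesis
      by (simp add: id lessThan_Suc_atMost[symmetric] add.commute)
  qed
  show "inj (linear_ext \<phi>)"
  proof (rule injI, rule fps_ext)
    fix f g n
    assume eq: "linear_ext \<phi> f = linear_ext \<phi> g"
    show "f $ n = g $ n"
    proof (induction n rule: less_induct)
      case (less n)
      then have "(\<Sum>i<n. \<phi> (n - i) (f $ i)) = (\<Sum>i<n. \<phi> (n - i) (g $ i))" by simp
      with nth[of f n] nth[of g n] eq show ?case by simp
    qed
  qed
  show "surj (linear_ext \<phi>)"
    unfolding surj_def
  proof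
    fix g
    \<comment> \<open>The preimage solves a recursion whose right-hand side involves only
      \<open>h i\<close> with \<open>i < n\<close>.\<close>
    have "\<exists>h. \<forall>n. h n = g $ n - (\<Sum>i<n. \<phi> (n - i) (h i))"
      by (rule dependent_wellorder_choice) auto
    then obtain h where "\<And>n. h n = g $ n - (\<Sum>i<n. \<phi> (n - i) (h i))" by blast
    then have "g = linear_ext \<phi> (Abs_fps h)"
      by (intro fps_ext) (simp add: nth algebra_simps)
    then show "\<exists>f. g = linear_ext \<phi> f" ..
  qed
qed

end

section \<open>Obstruction cocycles\<close>

lemma bilinear_ext_null_deformation_nth:
  "bilinear_ext (null_deformation \<mu>) f g $ n = (\<Sum>j\<le>n. \<mu> (f $ j) (g $ (n - j)))"
proof -
  have "bilinear_ext (null_deformation \<mu>) f g $ n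
      = (\<Sum>i\<le>n. if i = 0 then \<Sum>j\<le>n. \<mu> (f $ j) (g $ (n - j)) else 0)"
    unfolding bilinear_ext_nth by (rule sum.cong) (auto simp: null_deformation_def)
  then show ?thesis by simp
qed

context vector_space
begin

lemma linear_ext_const_nth:
  assumes "\<And>i. module_hom scale scale (\<phi> i)"
  shows "linear_ext \<phi> (fps_const x) $ n = \<phi> n x"
proof -
  have "linear_ext \<phi> (fps_const x) $ n = (\<Sum>i\<le>n. if i = n then \<phi> n x else 0)"
    unfolding linear_ext_nth by (rule sum.cong) (auto simp: module_hom.zero[OF assms])
  then show ?thesis by simp
qed

lemma bilinear_ext_const_nth:
  assumes "\<And>i. bilinear_map scale (d i)"
  shows "bilinear_ext d (fps_const x) (fps_const y) $ n = d n x y"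
proof -
  have "bilinear_ext d (fps_const x) (fps_const y) $ n
      = (\<Sum>i\<le>n. d i (fps_const x $ (n - i)) y)"
    unfolding bilinear_ext_right
    by (subst linear_ext_const_nth,
        rule module_hom_sum_self[OF bilinear_map_module_hom(1)[OF assms]], simp)
  also have "\<dots> = (\<Sum>i\<le>n. if i = n then d n x y else 0)"
    by (rule sum.cong) (auto simp: module_hom.zero[OF bilinear_map_module_hom(2)[OF assms]])
  finally show ?thesis by simp
qed

lemma bilinear_mapI:
  assumes "\<And>x. module_hom scale scale (f x)" "\<And>y. module_hom scale scale (\<lambda>x. f x y)"
  shows "bilinear_map scale f"
  using assms by (simp add: bilinear_map_def linearI_module_hom)

lemma module_pair_self: "module_pair scale scale"
  by (simp add: module_pair_def module_axioms)

section \<open>Closure properties of the cochain spaces\<close>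

lemma C1_module_hom: "f \<in> C1 scale \<alpha> \<beta> \<Longrightarrow> module_hom scale scale f"
  by (simp add: C1_def Vector_Spaces.linear_def)

lemma zero_in_C1:
  assumes "module_hom scale scale \<alpha>" "module_hom scale scale \<beta>"
  shows "(\<lambda>_. 0) \<in> C1 scale \<alpha> \<beta>"
  using assms module_pair.module_hom_zero[OF module_pair_self]
  by (simp add: C1_def linearI_module_hom module_hom.zero)

lemma id_in_C1: "id \<in> C1 scale \<alpha> \<beta>"
  using module_hom_id by (simp add: C1_def linearI_module_hom)

lemma C2_sum:
  assumes \<alpha>: "module_hom scale scale \<alpha>" and \<beta>: "module_hom scale scale \<beta>"
    and f: "\<And>i. i \<in> I \<Longrightarrow> f i \<in> C2 scale \<alpha> \<beta>"
  shows "(\<lambda>x y. \<Sum>i\<in>I. f i x y) \<in> C2 scale \<alpha> \<beta>"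
proof -
  have f': "bilinear_map scale (f i)" if "i \<in> I" for i
    using f[OF that] by (simp add: C2_def)
  have "bilinear_map scale (\<lambda>x y. \<Sum>i\<in>I. f i x y)"
    by (rule bilinear_mapI; rule module_hom_sum_self)
      (erule bilinear_map_module_hom[OF f'])+
  with f show ?thesis
    by (simp add: C2_def module_hom.sum[OF \<alpha>] module_hom.sum[OF \<beta>])
qed

lemma C2_diff:
  assumes \<alpha>: "module_hom scale scale \<alpha>" and \<beta>: "module_hom scale scale \<beta>"
    and f: "f \<in> C2 scale \<alpha> \<beta>" and g: "g \<in> C2 scale \<alpha> \<beta>"
  shows "(\<lambda>x y. f x y - g x y) \<in> C2 scale \<alpha> \<beta>"
proof -
  have "bilinear_map scale f" "bilinear_map scale g"
    using f g by (simp_all add: C2_def)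
  note hom = bilinear_map_module_hom[OF this(1)] bilinear_map_module_hom[OF this(2)]
  have "bilinear_map scale (\<lambda>x y. f x y - g x y)"
    by (rule bilinear_mapI; rule module_pair.module_hom_sub[OF module_pair_self]; rule hom)
  with f g show ?thesis
    by (simp add: C2_def module_hom.diff[OF \<alpha>] module_hom.diff[OF \<beta>])
qed

lemma C1_C2_compose:
  assumes "\<phi> \<in> C1 scale \<alpha> \<beta>" "f \<in> C2 scale \<alpha> \<beta>"
  shows "(\<lambda>x y. \<phi> (f x y)) \<in> C2 scale \<alpha> \<beta>"
proof -
  have f: "bilinear_map scale f" using assms by (simp add: C2_def)
  have "bilinear_map scale (\<lambda>x y. \<phi> (f x y))"
  proof (rule bilinear_mapI)
    fix x y
    show "module_hom scale scale (\<lambda>y. \<phi> (f x y))"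
      using module_hom_compose[OF bilinear_map_module_hom(1)[OF f] C1_module_hom[OF assms(1)]]
      by (simp add: comp_def)
    show "module_hom scale scale (\<lambda>x. \<phi> (f x y))"
      using module_hom_compose[OF bilinear_map_module_hom(2)[OF f] C1_module_hom[OF assms(1)]]
      by (simp add: comp_def)
  qed
  with assms show ?thesis by (simp add: C1_def C2_def)
qed

lemma C2_C1_C1_compose:
  assumes "f \<in> C2 scale \<alpha> \<beta>" "\<phi> \<in> C1 scale \<alpha> \<beta>" "\<psi> \<in> C1 scale \<alpha> \<beta>"
  shows "(\<lambda>x y. f (\<phi> x) (\<psi> y)) \<in> C2 scale \<alpha> \<beta>"
proof -
  have f: "bilinear_map scale f" using assms by (simp add: C2_def)
  have "bilinear_map scale (\<lambda>x y. f (\<phi> x) (\<psi> y))"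
  proof (rule bilinear_mapI)
    fix x y
    show "module_hom scale scale (\<lambda>y. f (\<phi> x) (\<psi> y))"
      using module_hom_compose[OF C1_module_hom[OF assms(3)] bilinear_map_module_hom(1)[OF f]]
      by (simp add: comp_def)
    show "module_hom scale scale (\<lambda>x. f (\<phi> x) (\<psi> y))"
      using module_hom_compose[OF C1_module_hom[OF assms(2)] bilinear_map_module_hom(2)[OF f]]
      by (simp add: comp_def)
  qed
  with assms show ?thesis by (simp add: C1_def C2_def)
qed

end

section \<open>The null deformation and the vanishing of \<open>H2\<close>\<close>

context left_bihom_alternative
begin

abbreviation M :: "'a fps \<Rightarrow> 'a fps \<Rightarrow> 'a fps" where
  "M \<equiv> bilinear_ext (null_deformation \<mu>)"

lemma module_hom_alpha: "module_hom scale scale \<alpha>"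
  using linear_alpha by (simp add: Vector_Spaces.linear_def)

lemma module_hom_beta: "module_hom scale scale \<beta>"
  using linear_beta by (simp add: Vector_Spaces.linear_def)

lemma mult_in_C2: "\<mu> \<in> C2 scale \<alpha> \<beta>"
  by (simp add: C2_def bilinear_mult alpha_mult beta_mult)

lemma bilinear_null_deformation: "bilinear_map scale (null_deformation \<mu> i)"
  using bilinear_mult module_pair.module_hom_zero[OF module_pair_self]
  by (simp add: null_deformation_def bilinear_mapI)

text \<open>The axiom of the algebra concerns single elements; it lifts to series because each
  coefficient is a sum of axiom instances over triples of coefficients of \<open>f\<close>,
  \<open>g\<close>, \<open>h\<close>.\<close>

lemma M_left_alternative:
  fixes f g h :: "'a fps"
  defines "A \<equiv> coeffwise \<alpha>" and "B \<equiv> coeffwise \<beta>"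
  shows "M (M (B f) (A g)) (B h) - M (A (B f)) (M (A g) h)
    + M (M (B g) (A f)) (B h) - M (A (B g)) (M (A f) h) = 0"
proof (rule fps_ext)
  fix n
  note hom = bilinear_map_module_hom[OF bilinear_mult]
  have as: "(M (M (B f) (A g)) (B h) - M (A (B f)) (M (A g) h)) $ n
      = (\<Sum>j\<le>n. \<Sum>i\<le>j. bihom_associator \<mu> \<alpha> \<beta> (\<beta> (f $ i)) (\<alpha> (g $ (j - i))) (h $ (n - j)))"
    for f g
  proof -
    have "M (M (B f) (A g)) (B h) $ n
        = (\<Sum>j\<le>n. \<Sum>i\<le>j. \<mu> (\<mu> (\<beta> (f $ i)) (\<alpha> (g $ (j - i)))) (\<beta> (h $ (n - j))))"
      by (simp add: bilinear_ext_null_deformation_nth A_def B_def coeffwise_def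
          module_hom.sum[OF hom(2)])
    moreover have "M (A (B f)) (M (A g) h) $ n
        = (\<Sum>j\<le>n. \<Sum>i\<le>n - j. \<mu> (\<alpha> (\<beta> (f $ j))) (\<mu> (\<alpha> (g $ i)) (h $ (n - j - i))))"
      by (simp add: bilinear_ext_null_deformation_nth A_def B_def coeffwise_def
          module_hom.sum[OF hom(1)])
    \<comment> \<open>The second product is regrouped to run over the same index pairs as the first,
      so that the two combine into associators.\<close>
    moreover have "\<dots> = (\<Sum>j\<le>n. \<Sum>i\<le>j. \<mu> (\<alpha> (\<beta> (f $ i))) (\<mu> (\<alpha> (g $ (j - i))) (h $ (n - j))))"
      by (rule sum_triangle_assoc[where
            F = "\<lambda>i j k. \<mu> (\<alpha> (\<beta> (f $ i))) (\<mu> (\<alpha> (g $ j)) (h $ k))", symmetric])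
    ultimately show ?thesis
      by (simp add: bihom_associator_def sum_subtractf)
  qed
  \<comment> \<open>Reversing the inner sum pairs each term with the term of the other sum that has
    the same coefficients of \<open>f\<close> and \<open>g\<close>.\<close>
  have "(\<Sum>i\<le>j. bihom_associator \<mu> \<alpha> \<beta> (\<beta> (g $ i)) (\<alpha> (f $ (j - i))) (h $ (n - j)))
      = (\<Sum>i\<le>j. bihom_associator \<mu> \<alpha> \<beta> (\<beta> (g $ (j - i))) (\<alpha> (f $ i)) (h $ (n - j)))" for j
    by (rule sum_atMost_rev[where
          F = "\<lambda>i k. bihom_associator \<mu> \<alpha> \<beta> (\<beta> (g $ i)) (\<alpha> (f $ k)) (h $ (n - j))"])
  then have "(M (M (B f) (A g)) (B h) - M (A (B f)) (M (A g) h)) $ n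
      + (M (M (B g) (A f)) (B h) - M (A (B g)) (M (A f) h)) $ n = 0"
    unfolding as by (simp add: sum.distrib[symmetric] left_alternative)
  then show "(M (M (B f) (A g)) (B h) - M (A (B f)) (M (A g) h)
      + M (M (B g) (A f)) (B h) - M (A (B g)) (M (A f) h)) $ n = 0 $ n"
    by (simp add: algebra_simps)
qed

text \<open>As \<open>B2\<close> contains zero, \<open>f\<close> lies in its own coset, which by
  hypothesis is the coset of zero, that is, \<open>B2\<close> itself.\<close>

lemma H2_trivial_imp_B2:
  assumes "H2 scale \<mu> \<alpha> \<beta> = {H2_zero scale \<mu> \<alpha> \<beta>}" "f \<in> Z2 scale \<mu> \<alpha> \<beta>"
  shows "f \<in> B2 scale \<mu> \<alpha> \<beta>"
proof -
  have "delta1 \<mu> (\<lambda>_. 0) = (\<lambda>_ _. 0)"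
    by (simp add: fun_eq_iff delta1_def
        module_hom.zero[OF bilinear_map_module_hom(1)[OF bilinear_mult]]
        module_hom.zero[OF bilinear_map_module_hom(2)[OF bilinear_mult]])
  then have "(\<lambda>_ _. 0) \<in> B2 scale \<mu> \<alpha> \<beta>"
    using zero_in_C1[OF module_hom_alpha module_hom_beta] unfolding B2_def by (metis imageI)
  then have "f \<in> B2_coset scale \<mu> \<alpha> \<beta> f"
    unfolding B2_coset_def by (intro image_eqI[where x = "\<lambda>_ _. 0"]) auto
  also have "B2_coset scale \<mu> \<alpha> \<beta> f = B2_coset scale \<mu> \<alpha> \<beta> (\<lambda>_ _. 0)"
    using assms by (auto simp: H2_def H2_zero_def)
  finally show ?thesis by (auto simp: B2_coset_def)
qed

end

section \<open>The defect of a formal map and its leading coefficient\<close>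

locale left_bihom_deformation = left_bihom_alternative scale \<mu> \<alpha> \<beta>
  for scale :: "'k::field \<Rightarrow> 'a::ab_group_add \<Rightarrow> 'a" and \<mu> \<alpha> \<beta> +
  fixes d :: "nat \<Rightarrow> 'a \<Rightarrow> 'a \<Rightarrow> 'a"
  assumes deformation: "formal_deformation scale \<mu> \<alpha> \<beta> d"
begin

abbreviation D :: "'a fps \<Rightarrow> 'a fps \<Rightarrow> 'a fps" where
  "D \<equiv> bilinear_ext d"

text \<open>Defined on all series, since the iterated products in the left alternative identity of
  \<open>D\<close> have nonconstant inner factors.\<close>

definition defect :: "(nat \<Rightarrow> 'a \<Rightarrow> 'a) \<Rightarrow> 'a fps \<Rightarrow> 'a fps \<Rightarrow> 'a fps" where
  "defect \<phi> f g = linear_ext \<phi> (D f g) - M (linear_ext \<phi> f) (linear_ext \<phi> g)"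

lemma bilinear_d: "bilinear_map scale (d i)"
  using deformation by (simp add: formal_deformation_def)

lemma d_0: "d 0 = \<mu>"
  using deformation by (simp add: formal_deformation_def)

lemma D_left_alternative:
  fixes x y z :: 'a
  defines "c \<equiv> fps_const"
  shows "D (D (c (\<beta> x)) (c (\<alpha> y))) (c (\<beta> z)) - D (c (\<alpha> (\<beta> x))) (D (c (\<alpha> y)) (c z))
    + D (D (c (\<beta> y)) (c (\<alpha> x))) (c (\<beta> z)) - D (c (\<alpha> (\<beta> y))) (D (c (\<alpha> x)) (c z)) = 0"
  using deformation by (simp add: formal_deformation_def Let_def c_def)

lemmas D_const_nth = bilinear_ext_const_nth[of d, OF bilinear_d]

lemma d_in_C2: "d i \<in> C2 scale \<alpha> \<beta>"
proof -
  have "D (fps_const (\<alpha> x)) (fps_const (\<alpha> y)) $ i = coeffwise \<alpha> (D (fps_const x) (fps_const y)) $ i"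
    "D (fps_const (\<beta> x)) (fps_const (\<beta> y)) $ i = coeffwise \<beta> (D (fps_const x) (fps_const y)) $ i"
    for x y
    using deformation by (simp_all add: formal_deformation_def Let_def)
  then show ?thesis
    by (simp add: C2_def bilinear_d D_const_nth coeffwise_def)
qed

context
  fixes \<phi> :: "nat \<Rightarrow> 'a \<Rightarrow> 'a"
  assumes \<phi>_C1: "\<And>i. \<phi> i \<in> C1 scale \<alpha> \<beta>" and \<phi>_0: "\<phi> 0 = id"
begin

abbreviation \<Phi> :: "'a fps \<Rightarrow> 'a fps" where
  "\<Phi> \<equiv> linear_ext \<phi>"

lemma module_hom_\<Phi>: "module_hom (fps_scale scale) (fps_scale scale) \<Phi>"
  by (intro module_hom_linear_ext C1_module_hom[OF \<phi>_C1])

lemma \<Phi>_coeffwise: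
  "\<Phi> (coeffwise \<alpha> f) = coeffwise \<alpha> (\<Phi> f)" "\<Phi> (coeffwise \<beta> f) = coeffwise \<beta> (\<Phi> f)"
proof -
  have "\<alpha> (\<phi> i x) = \<phi> i (\<alpha> x)" "\<beta> (\<phi> i x) = \<phi> i (\<beta> x)" for i x
    using \<phi>_C1 by (simp_all add: C1_def)
  then show "\<Phi> (coeffwise \<alpha> f) = coeffwise \<alpha> (\<Phi> f)" "\<Phi> (coeffwise \<beta> f) = coeffwise \<beta> (\<Phi> f)"
    by (simp_all add: fps_eq_iff linear_ext_nth coeffwise_def
        module_hom.sum[OF module_hom_alpha] module_hom.sum[OF module_hom_beta])
qed

text \<open>Linearity over \<open>K[[t]]\<close> in each argument is what allows the defect to be
  tested on constants.\<close>

lemma module_hom_defect: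
  "module_hom (fps_scale scale) (fps_scale scale) (defect \<phi> f)"
  "module_hom (fps_scale scale) (fps_scale scale) (\<lambda>f. defect \<phi> f g)"
proof -
  have pair: "module_pair (fps_scale scale) (fps_scale scale)"
    by (simp add: module_pair_def module_fps_scale)
  note D = module_hom_bilinear_ext[of d, OF bilinear_d]
    and M = module_hom_bilinear_ext[of "null_deformation \<mu>", OF bilinear_null_deformation]
  show "module_hom (fps_scale scale) (fps_scale scale) (defect \<phi> f)"
    unfolding defect_def[abs_def]
    using module_pair.module_hom_sub[OF pair module_hom_compose[OF D(1) module_hom_\<Phi>]
        module_hom_compose[OF module_hom_\<Phi> M(1)]]
    by (simp add: comp_def)
  show "module_hom (fps_scale scale) (fps_scale scale) (\<lambda>f. defect \<phi> f g)"
    unfolding defect_def[abs_def]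
    using module_pair.module_hom_sub[OF pair module_hom_compose[OF D(2) module_hom_\<Phi>]
        module_hom_compose[OF module_hom_\<Phi> M(2)]]
    by (simp add: comp_def)
qed

lemma \<Phi>_nth_0: "\<Phi> f $ 0 = f $ 0"
  by (simp add: linear_ext_nth \<phi>_0)

lemma D_nth_0: "D f g $ 0 = \<mu> (f $ 0) (g $ 0)"
  by (simp add: bilinear_ext_nth d_0)

lemma defect_const_nth:
  "defect \<phi> (fps_const x) (fps_const y) $ n
    = (\<Sum>i\<le>n. \<phi> i (d (n - i) x y)) - (\<Sum>i\<le>n. \<mu> (\<phi> i x) (\<phi> (n - i) y))"
  unfolding defect_def fps_sub_nth bilinear_ext_null_deformation_nth
    linear_ext_const_nth[where \<phi> = \<phi>, OF C1_module_hom[OF \<phi>_C1]]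
  by (simp add: linear_ext_nth D_const_nth)

text \<open>\<open>module_hom_fps_nth_le\<close> is applied to one argument at a time: the left one
  against constants, then the right one for arbitrary \<open>f\<close>.\<close>

lemma defect_nth_le:
  assumes "\<And>m x y. m < n \<Longrightarrow> defect \<phi> (fps_const x) (fps_const y) $ m = 0" "m \<le> n"
  shows "defect \<phi> f g $ m = defect \<phi> (fps_const (f $ 0)) (fps_const (g $ 0)) $ m"
proof -
  have left: "defect \<phi> f (fps_const y) $ k = defect \<phi> (fps_const (f $ 0)) (fps_const y) $ k"
    if "k \<le> n" for y k
    using that assms(1) by (intro module_hom_fps_nth_le[OF module_hom_defect(2), of n])
  have "defect \<phi> f g $ m = defect \<phi> f (fps_const (g $ 0)) $ m"
    using assms left by (intro module_hom_fps_nth_le[OF module_hom_defect(1), of n]) auto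
  with left[OF assms(2)] show ?thesis by simp
qed

lemma obstruction_in_Z2:
  assumes van: "\<And>m x y. m < n \<Longrightarrow> defect \<phi> (fps_const x) (fps_const y) $ m = 0"
  shows "(\<lambda>x y. defect \<phi> (fps_const x) (fps_const y) $ n) \<in> Z2 scale \<mu> \<alpha> \<beta>"
proof -
  define \<psi> where "\<psi> x y = defect \<phi> (fps_const x) (fps_const y) $ n" for x y
  have "\<psi> \<in> C2 scale \<alpha> \<beta>"
    unfolding \<psi>_def[abs_def] defect_const_nth
    by (rule C2_diff[OF module_hom_alpha module_hom_beta];
        rule C2_sum[OF module_hom_alpha module_hom_beta])
      (rule C1_C2_compose[OF \<phi>_C1 d_in_C2] C2_C1_C1_compose[OF mult_in_C2 \<phi>_C1 \<phi>_C1])+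
  moreover have "delta2 \<mu> \<alpha> \<beta> \<psi> x y z = 0" for x y z
  proof -
    define c where "c = (fps_const :: 'a \<Rightarrow> 'a fps)"
    have c0: "c x $ 0 = x" for x by (simp add: c_def)
    note hom = bilinear_map_module_hom[OF bilinear_mult]
    have \<Phi>D: "\<Phi> (D f g) = M (\<Phi> f) (\<Phi> g) + defect \<phi> f g" for f g
      by (simp add: defect_def)
    note Mhom = module_hom_bilinear_ext[of "null_deformation \<mu>", OF bilinear_null_deformation]
    have defect_low: "defect \<phi> f g $ m = 0" if "m < n" for f g m
      using defect_nth_le[where f = f and g = g and m = m, OF van] van that by simp
    have defect_n: "defect \<phi> f g $ n = \<psi> (f $ 0) (g $ 0)" for f g
      using defect_nth_le[where f = f and g = g and m = n, OF van order_refl] by (simp add: \<psi>_def)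
    \<comment> \<open>The defect starts at order \<open>n\<close>, so in the product only its
      leading coefficient meets the constant term of \<open>\<Phi> h\<close>, which is
      \<open>h $ 0\<close>.\<close>
    have M_left: "M (defect \<phi> f g) (\<Phi> h) $ n = \<mu> (\<psi> (f $ 0) (g $ 0)) (h $ 0)" for f g h
    proof -
      have "M (defect \<phi> f g) (\<Phi> h) $ n
          = (\<Sum>j\<le>n. if j = n then \<mu> (\<psi> (f $ 0) (g $ 0)) (h $ 0) else 0)"
        unfolding bilinear_ext_null_deformation_nth
        by (rule sum.cong) (auto simp: defect_low defect_n \<Phi>_nth_0 module_hom.zero[OF hom(2)])
      then show ?thesis by simp
    qed
    have M_right: "M (\<Phi> h) (defect \<phi> f g) $ n = \<mu> (h $ 0) (\<psi> (f $ 0) (g $ 0))" for f g h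
    proof -
      have "M (\<Phi> h) (defect \<phi> f g) $ n
          = (\<Sum>j\<le>n. if j = 0 then \<mu> (h $ 0) (\<psi> (f $ 0) (g $ 0)) else 0)"
        unfolding bilinear_ext_null_deformation_nth
        by (rule sum.cong) (auto simp: defect_low defect_n \<Phi>_nth_0 module_hom.zero[OF hom(1)])
      then show ?thesis by simp
    qed
    \<comment> \<open>Moving \<open>\<Phi>\<close> inside twice leaves two errors: the inner defect
      times \<open>\<Phi> (c w)\<close>, and the outer defect at \<open>D (c u) (c v)\<close>, whose
      constant term is \<open>\<mu> u v\<close>. With those in \<open>R\<close> they supply all the
      terms of \<open>delta2\<close>.\<close>
    have L: "\<Phi> (D (D (c u) (c v)) (c w)) $ n
        = M (M (\<Phi> (c u)) (\<Phi> (c v))) (\<Phi> (c w)) $ n + \<mu> (\<psi> u v) w + \<psi> (\<mu> u v) w" for u v w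
      by (simp add: \<Phi>D module_hom.add[OF Mhom(2)] M_left defect_n D_nth_0 c0)
    have R: "\<Phi> (D (c u) (D (c v) (c w))) $ n
        = M (\<Phi> (c u)) (M (\<Phi> (c v)) (\<Phi> (c w))) $ n + \<mu> u (\<psi> v w) + \<psi> u (\<mu> v w)" for u v w
      by (simp add: \<Phi>D module_hom.add[OF Mhom(1)] M_right defect_n D_nth_0 c0)
    \<comment> \<open>Allows \<open>\<alpha>\<close> and \<open>\<beta>\<close> to be pulled out
      through \<open>\<Phi>\<close>, giving the form required by
      \<open>M_left_alternative\<close>.\<close>
    have coeffwise_c: "c (\<alpha> x) = coeffwise \<alpha> (c x)" "c (\<beta> x) = coeffwise \<beta> (c x)" for x
      by (auto intro!: fps_ext simp: c_def coeffwise_def module_hom.zero[OF module_hom_alpha]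
          module_hom.zero[OF module_hom_beta])
    have "\<Phi> (D (D (c (\<beta> x)) (c (\<alpha> y))) (c (\<beta> z)) - D (c (\<alpha> (\<beta> x))) (D (c (\<alpha> y)) (c z))
      + D (D (c (\<beta> y)) (c (\<alpha> x))) (c (\<beta> z)) - D (c (\<alpha> (\<beta> y))) (D (c (\<alpha> x)) (c z))) $ n = 0"
      unfolding c_def D_left_alternative by (simp add: module_hom.zero[OF module_hom_\<Phi>])
    then have "\<Phi> (D (D (c (\<beta> x)) (c (\<alpha> y))) (c (\<beta> z))) $ n
        - \<Phi> (D (c (\<alpha> (\<beta> x))) (D (c (\<alpha> y)) (c z))) $ n
        + \<Phi> (D (D (c (\<beta> y)) (c (\<alpha> x))) (c (\<beta> z))) $ n
        - \<Phi> (D (c (\<alpha> (\<beta> y))) (D (c (\<alpha> x)) (c z))) $ n = 0"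
      by (simp add: module_hom.add[OF module_hom_\<Phi>] module_hom.diff[OF module_hom_\<Phi>])
    moreover have "(M (M (\<Phi> (c (\<beta> x))) (\<Phi> (c (\<alpha> y)))) (\<Phi> (c (\<beta> z)))
        - M (\<Phi> (c (\<alpha> (\<beta> x)))) (M (\<Phi> (c (\<alpha> y))) (\<Phi> (c z)))
        + M (M (\<Phi> (c (\<beta> y))) (\<Phi> (c (\<alpha> x)))) (\<Phi> (c (\<beta> z)))
        - M (\<Phi> (c (\<alpha> (\<beta> y)))) (M (\<Phi> (c (\<alpha> x))) (\<Phi> (c z)))) $ n = 0"
      by (simp only: coeffwise_c \<Phi>_coeffwise M_left_alternative fps_zero_nth)
    ultimately show ?thesis
      unfolding L R delta2_def by (simp add: algebra_simps)
  qed
  ultimately show ?thesis by (simp add: Z2_def \<psi>_def[abs_def])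
qed

end

text \<open>Replacing the zero coefficient at \<open>n\<close> by \<open>r\<close> changes the
  defect at order \<open>n\<close> by minus \<open>delta1 \<mu> r\<close>, so \<open>r\<close> is
  chosen with \<open>delta1 \<mu> r\<close> equal to that defect. The result is given as coefficient
  sums, which make sense for any sequence, whereas \<open>defect_const_nth\<close> needs every
  coefficient in \<open>C1\<close>.\<close>

lemma extend_morphism:
  assumes H2: "H2 scale \<mu> \<alpha> \<beta> = {H2_zero scale \<mu> \<alpha> \<beta>}"
    and \<phi>: "\<And>i. \<phi> i \<in> C1 scale \<alpha> \<beta>" "\<phi> 0 = id" "\<phi> n = (\<lambda>_. 0)" and "n > 0"
    and van: "\<And>m x y. m < n \<Longrightarrow> defect \<phi> (fps_const x) (fps_const y) $ m = 0"
  obtains r where "r \<in> C1 scale \<alpha> \<beta>"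
    and "\<And>x y. (\<Sum>i\<le>n. (\<phi>(n := r)) i (d (n - i) x y))
      = (\<Sum>i\<le>n. \<mu> ((\<phi>(n := r)) i x) ((\<phi>(n := r)) (n - i) y))"
proof -
  have "(\<lambda>x y. defect \<phi> (fps_const x) (fps_const y) $ n) \<in> B2 scale \<mu> \<alpha> \<beta>"
    by (intro H2_trivial_imp_B2[OF H2] obstruction_in_Z2 \<phi> van)
  then obtain r where r: "r \<in> C1 scale \<alpha> \<beta>"
    and eq: "\<And>x y. defect \<phi> (fps_const x) (fps_const y) $ n = delta1 \<mu> r x y"
    by (auto simp: B2_def fun_eq_iff)
  note zero = module_hom.zero[OF bilinear_map_module_hom(1)[OF bilinear_mult]]
    module_hom.zero[OF bilinear_map_module_hom(2)[OF bilinear_mult]]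
  show thesis
  proof (rule that[OF r])
    fix x y
    have "(\<Sum>i\<le>n. (\<phi>(n := r)) i (d (n - i) x y))
        = (\<Sum>i\<le>n. \<phi> i (d (n - i) x y) + (if i = n then r (\<mu> x y) else 0))"
      by (rule sum.cong) (auto simp: \<phi> d_0)
    \<comment> \<open>Only the two end terms change; they are distinct because \<open>n > 0\<close>,
      and each has a factor \<open>\<phi> 0 = id\<close>.\<close>
    moreover have "(\<Sum>i\<le>n. \<mu> ((\<phi>(n := r)) i x) ((\<phi>(n := r)) (n - i) y))
        = (\<Sum>i\<le>n. \<mu> (\<phi> i x) (\<phi> (n - i) y)
            + ((if i = n then \<mu> (r x) y else 0) + (if i = 0 then \<mu> x (r y) else 0)))"
      using \<open>n > 0\<close> by (intro sum.cong) (auto simp: \<phi> zero)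
    ultimately show "(\<Sum>i\<le>n. (\<phi>(n := r)) i (d (n - i) x y))
        = (\<Sum>i\<le>n. \<mu> ((\<phi>(n := r)) i x) ((\<phi>(n := r)) (n - i) y))"
      using eq[of x y] unfolding defect_const_nth[where \<phi> = \<phi>, OF \<phi>(1,2)] delta1_def
      by (simp add: sum.distrib algebra_simps)
  qed
qed

lemma deformation_equiv_null:
  assumes H2: "H2 scale \<mu> \<alpha> \<beta> = {H2_zero scale \<mu> \<alpha> \<beta>}"
  shows "deformation_equiv scale \<alpha> \<beta> d (null_deformation \<mu>)"
proof -
  \<comment> \<open>\<open>P \<phi> n r\<close> says that \<open>r\<close> is an admissible
    coefficient at \<open>n\<close>. It depends on \<open>\<phi>\<close> only below
    \<open>n\<close>, as well-founded dependent choice requires.\<close>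
  define P where "P \<phi> n r \<longleftrightarrow> r \<in> C1 scale \<alpha> \<beta> \<and> (n = 0 \<longrightarrow> r = id) \<and>
    (\<forall>x y. (\<Sum>i\<le>n. (\<phi>(n := r)) i (d (n - i) x y))
      = (\<Sum>i\<le>n. \<mu> ((\<phi>(n := r)) i x) ((\<phi>(n := r)) (n - i) y)))" for \<phi> n r
  have "\<exists>\<phi>. \<forall>n. P \<phi> n (\<phi> n)"
  proof (rule dependent_wellorder_choice)
    fix r and \<phi> \<chi> :: "nat \<Rightarrow> 'a \<Rightarrow> 'a" and n :: nat
    assume eq: "\<And>m. m < n \<Longrightarrow> \<phi> m = \<chi> m"
    have "(\<phi>(n := r)) i = (\<chi>(n := r)) i" if "i \<le> n" for i
      using that eq by auto
    then show "P \<phi> n r = P \<chi> n r"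
      unfolding P_def by (simp del: fun_upd_apply)
  next
    fix n :: nat and \<phi> :: "nat \<Rightarrow> 'a \<Rightarrow> 'a"
    assume IH: "\<And>m. m < n \<Longrightarrow> P \<phi> m (\<phi> m)"
    show "\<exists>r. P \<phi> n r"
    proof (cases "n = 0")
      case True
      then have "P \<phi> n id" by (simp add: P_def id_in_C1 d_0)
      then show ?thesis by blast
    next
      case False
      \<comment> \<open>The induction hypothesis says nothing about \<open>\<phi>\<close> from
        \<open>n\<close> on. Truncating by zero gives a sequence in \<open>C1\<close> that vanishes
        at \<open>n\<close>, as \<open>extend_morphism\<close> demands.\<close>
      define \<chi> where "\<chi> i = (if i < n then \<phi> i else (\<lambda>_. 0))" for i
      have \<chi>: "\<chi> i \<in> C1 scale \<alpha> \<beta>" "\<chi> 0 = id" "\<chi> n = (\<lambda>_. 0)" for i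
        using IH False zero_in_C1[OF module_hom_alpha module_hom_beta]
        by (auto simp: \<chi>_def P_def)
      \<comment> \<open>Order \<open>m\<close> involves only coefficients up to
        \<open>m < n\<close>, where \<open>\<chi>\<close> agrees with \<open>\<phi>\<close>.\<close>
      have van: "defect \<chi> (fps_const x) (fps_const y) $ m = 0" if "m < n" for m x y
        using IH[OF that] that unfolding defect_const_nth[where \<phi> = \<chi>, OF \<chi>(1,2)] P_def
        by (simp add: \<chi>_def less_imp_diff_less)
      from \<open>n \<noteq> 0\<close> obtain r where r: "r \<in> C1 scale \<alpha> \<beta>"
        "\<And>x y. (\<Sum>i\<le>n. (\<chi>(n := r)) i (d (n - i) x y))
          = (\<Sum>i\<le>n. \<mu> ((\<chi>(n := r)) i x) ((\<chi>(n := r)) (n - i) y))"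
        using extend_morphism[OF H2 \<chi> _ van] by blast
      have "(\<phi>(n := r)) i = (\<chi>(n := r)) i" if "i \<le> n" for i
        using that by (simp add: \<chi>_def)
      with r \<open>n \<noteq> 0\<close> have "P \<phi> n r"
        unfolding P_def by (simp del: fun_upd_apply)
      then show ?thesis by blast
    qed
  qed
  then obtain \<phi> where P: "\<And>n. P \<phi> n (\<phi> n)" by blast
  have \<phi>: "\<phi> i \<in> C1 scale \<alpha> \<beta>" "\<phi> 0 = id" for i
    using P by (auto simp: P_def)
  have const: "defect \<phi> (fps_const x) (fps_const y) $ n = 0" for x y n
    using P[of n] by (simp add: defect_const_nth[where \<phi> = \<phi>, OF \<phi>] P_def)
  \<comment> \<open>On constants the defect vanishes to every order, so \<open>defect_nth_le\<close>
    applies with an arbitrary bound and extends this to all series.\<close>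
  have "defect \<phi> f g = 0" for f g
    using defect_nth_le[where \<phi> = \<phi>, OF \<phi> const order_refl] const by (intro fps_ext) simp
  then have "\<Phi> \<phi> (D f g) = M (\<Phi> \<phi> f) (\<Phi> \<phi> g)" for f g
    by (simp add: defect_def)
  then show ?thesis
    unfolding deformation_equiv_def Let_def
    using \<phi> module_hom_\<Phi>[where \<phi> = \<phi>, OF \<phi>] bij_linear_ext[where \<phi> = \<phi>, OF C1_module_hom[OF \<phi>(1)] \<phi>(2)]
      \<Phi>_coeffwise[where \<phi> = \<phi>, OF \<phi>] linearI_module_hom[OF C1_module_hom[OF \<phi>(1)]]
    by (intro exI[of _ \<phi>]) (auto simp: fun_eq_iff)
qed

end

theorem theorem3p4:
  fixes scale :: "'k::field_char_0 \<Rightarrow> 'a::ab_group_add \<Rightarrow> 'a"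
    and \<mu> :: "'a \<Rightarrow> 'a \<Rightarrow> 'a" and \<alpha> \<beta> :: "'a \<Rightarrow> 'a"
  assumes "left_bihom_alternative scale \<mu> \<alpha> \<beta>"
    and "H2 scale \<mu> \<alpha> \<beta> = {H2_zero scale \<mu> \<alpha> \<beta>}"
  shows "analytically_rigid scale \<mu> \<alpha> \<beta>"
  unfolding analytically_rigid_def trivial_deformation_def
proof (intro allI impI)
  fix d
  assume "formal_deformation scale \<mu> \<alpha> \<beta> d"
  with assms(1) interpret left_bihom_deformation scale \<mu> \<alpha> \<beta> d
    by (intro left_bihom_deformation.intro left_bihom_deformation_axioms.intro)
  show "deformation_equiv scale \<alpha> \<beta> d (null_deformation (d 0))"
    unfolding d_0 by (rule deformation_equiv_null[OF assms(2)])
qed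

end
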